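(* For each function $f\in\mathcal{T}_H^O$ there exists an open set $V$ with $(-1,1)\subset V\subset\mathbb{D}$ such that $f$ is univalent on $V$.
   Context: $\mathbb{D}=\{z\in\mathbb{C}:|z|<1\}$. A (complex-valued) harmonic function $f$ on $\mathbb{D}$ can be written $f=h+\overline{g}$ with $h,g$ analytic on $\mathbb{D}$; let $\omega$ be the meromorphic function given by $g'=\omega h'$ (removable singularities removed). $f$ is sense-preserving at $z_0\in\mathbb{D}$ if $h'\not\equiv 0$ in some neighborhood of $z_0$ and $\omega$ is analytic at $z_0$ with $|\omega(z_0)|<1$ (so $h'(z_0)=0$ is allowed); $f$ is sense-preserving in $\mathbb{D}$ if it is so at every point of $\mathbb{D}$. The class $\mathcal{T}_H$ consists of all sense-preserving harmonic functions $f=h+\overline{g}$ on $\mathbb{D}$ such that $f(z)$ is real if and only if $z$ is real, $f(0)=0$, $|h'(0)|=1$, and $f(r)>0$ for $0<r<1$. $\mathcal{T}_H^O$ is the subclass of those $f\in\mathcal{T}_H$ with $g'(0)=0$. Univalent means injective. *)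

theory Defs
  imports "HOL-Complex_Analysis.Complex_Analysis"
begin

abbreviation unit_disk :: "complex set" where
  "unit_disk \<equiv> ball 0 1"

text \<open>
  Complex-valued harmonic functions on an open set \<open>S\<close>: twice continuously differentiable (the
  first partials \<open>fx\<close>, \<open>fy\<close> are themselves totally differentiable with continuous partials),
  with vanishing Laplacian.
\<close>
definition harmonic_on :: "(complex \<Rightarrow> complex) \<Rightarrow> complex set \<Rightarrow> bool" where
  "harmonic_on f S \<longleftrightarrow>
     (\<exists>fx fy fxx fxy fyx fyy.
        (\<forall>z\<in>S. (f has_derivative (\<lambda>v. Re v *\<^sub>R fx z + Im v *\<^sub>R fy z)) (at z)) \<and>
        (\<forall>z\<in>S. (fx has_derivative (\<lambda>v. Re v *\<^sub>R fxx z + Im v *\<^sub>R fxy z)) (at z)) \<and>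
        (\<forall>z\<in>S. (fy has_derivative (\<lambda>v. Re v *\<^sub>R fyx z + Im v *\<^sub>R fyy z)) (at z)) \<and>
        continuous_on S fxx \<and> continuous_on S fxy \<and>
        continuous_on S fyx \<and> continuous_on S fyy \<and>
        (\<forall>z\<in>S. fxx z + fyy z = 0))"

text \<open>
  The decomposition \<open>f = h + cnj g\<close>. On the disk it exists for every harmonic \<open>f\<close>, and \<open>h\<close>, \<open>g\<close>
  are unique up to additive constants, so conditions on their derivatives depend on \<open>f\<close> only.
\<close>
definition harmonic_decomp ::
    "(complex \<Rightarrow> complex) \<Rightarrow> (complex \<Rightarrow> complex) \<Rightarrow> (complex \<Rightarrow> complex) \<Rightarrow> bool" where
  "harmonic_decomp f h g \<longleftrightarrow>
     h holomorphic_on unit_disk \<and> g holomorphic_on unit_disk \<and>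
     (\<forall>z\<in>unit_disk. f z = h z + cnj (g z))"

text \<open>
  The meromorphic \<open>\<omega>\<close> with \<open>g' = \<omega> h'\<close>. At poles \<^const>\<open>remove_sings\<close> returns the junk value \<open>0\<close>,
  but the function is then not analytic there. If \<open>h'\<close> vanishes identically then \<open>\<omega>\<close> is
  meaningless; that case is excluded separately in the next definition.
\<close>
definition dilatation ::
    "(complex \<Rightarrow> complex) \<Rightarrow> (complex \<Rightarrow> complex) \<Rightarrow> complex \<Rightarrow> complex" where
  "dilatation h g = remove_sings (\<lambda>z. deriv g z / deriv h z)"

definition sense_preserving_at :: "(complex \<Rightarrow> complex) \<Rightarrow> complex \<Rightarrow> bool" where
  "sense_preserving_at f z0 \<longleftrightarrow>
     (\<exists>h g. harmonic_decomp f h g \<and>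
        \<not> (\<forall>\<^sub>F z in nhds z0. deriv h z = 0) \<and>
        dilatation h g analytic_on {z0} \<and>
        norm (dilatation h g z0) < 1)"

definition class_TH :: "(complex \<Rightarrow> complex) set" where
  "class_TH = {f.
     harmonic_on f unit_disk \<and>
     (\<forall>z\<in>unit_disk. sense_preserving_at f z) \<and>
     (\<forall>z\<in>unit_disk. f z \<in> \<real> \<longleftrightarrow> z \<in> \<real>) \<and>
     f 0 = 0 \<and>
     (\<exists>h g. harmonic_decomp f h g \<and> norm (deriv h 0) = 1) \<and>
     (\<forall>r::real. 0 < r \<and> r < 1 \<longrightarrow> f (of_real r) \<in> \<real> \<and> Re (f (of_real r)) > 0)}"

definition class_THO :: "(complex \<Rightarrow> complex) set" where
  "class_THO = {f \<in> class_TH. \<exists>h g. harmonic_decomp f h g \<and> deriv g 0 = 0}"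

end

theory Submission
  imports Defs
begin

text \<open>
  Write \<open>f = h + cnj g\<close>. The imaginary part of \<open>f\<close> is that of the holomorphic function
  \<open>F = h - g\<close>, so \<open>F\<close> too is real exactly on the real axis. If \<open>F'\<close> vanished at a point \<open>x\<close> of
  the axis, \<open>Im F\<close> would change sign between neighbouring sectors at \<open>x\<close>, two of which meet the
  upper half plane, and \<open>F\<close> would be real somewhere off the axis. Hence \<open>h' - g' = F' \<noteq> 0\<close> on the
  axis (\<open>deriv_nonzero_if_real_iff_real\<close>). Sense preservation gives \<open>g' = \<omega> h'\<close> with
  \<open>\<bar>\<omega>\<bar> < 1\<close>. So \<open>h'\<close>, which might vanish elsewhere in the disk, cannot vanish on the axis, and
  the Jacobian \<open>\<bar>h'\<bar>\<^sup>2 - \<bar>g'\<bar>\<^sup>2\<close> is positive there.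

  This has two consequences at each \<open>x\<close> in \<open>(-1,1)\<close>: \<open>f\<close> is injective on a ball around \<open>x\<close>
  (\<open>locally_injective_if_norm_deriv_less\<close>), and the real function \<open>t \<mapsto> f t\<close> has nonzero derivative
  at \<open>x\<close>. By Rolle's theorem the latter makes \<open>f\<close> a homeomorphism of the interval \<open>(-1,1)\<close> onto
  an open interval.

  Local injectivity and injectivity on the axis must be glued together although the axis is not
  compact, so that the radii of the balls need not have a positive lower bound. Sending \<open>z\<close> near the
  axis to the axis point \<open>p z\<close> with \<open>f (p z) = Re (f z)\<close> is a continuous retraction that depends on \<open>f z\<close> alone. Two
  points with equal \<open>f\<close>-value therefore lie over the same axis point; if each is close to it, both
  lie in one ball on which \<open>f\<close> is injective (\<open>injective_neighbourhood_if_fibres_retract\<close>).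
\<close>

section \<open>Holomorphic functions that are real exactly on the real axis\<close>

text \<open>
  Near \<open>c = x\<close> one has \<open>F z - F c = (z - c) ^ n * q z\<close> with \<open>q c\<close> real and nonzero, so on the ray
  at angle \<open>\<theta>\<close> the sign of \<open>Im F\<close> close to \<open>c\<close> is that of \<open>sin (n * \<theta>) * q c\<close> if this is nonzero. For \<open>n \<ge> 2\<close> both signs occur
  for \<open>\<theta>\<close> in \<open>(0,\<pi>)\<close>, whereas \<open>Im F\<close> has no zero on the connected upper half of a disk. Hence
  \<open>n = 1\<close> and \<open>F' c = q c\<close>.
\<close>
lemma deriv_nonzero_if_real_iff_real:
  assumes hol: "F holomorphic_on S" and "open S" "complex_of_real x \<in> S"
    and re: "\<And>z. z \<in> S \<Longrightarrow> F z \<in> \<real> \<longleftrightarrow> z \<in> \<real>"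
  shows "deriv F (of_real x) \<noteq> 0"
proof -
  define c where "c = complex_of_real x"
  obtain e where e: "e > 0" "ball c e \<subseteq> S"
    using assms unfolding c_def by (meson openE)
  define G where "G z = F z - F c" for z
  have Gre: "G z \<in> \<real> \<longleftrightarrow> z \<in> \<real>" if "z \<in> ball c e" for z
  proof -
    have "F c \<in> \<real>" using re[of c] assms(3) by (simp add: c_def)
    then show ?thesis
      using re[of z] e that unfolding G_def by (metis Reals_diff Reals_add diff_add_cancel subsetD)
  qed
  have holG: "G holomorphic_on ball c e"
    unfolding G_def using hol e by (intro holomorphic_intros) (auto elim: holomorphic_on_subset)
  have nc: "\<not> G constant_on ball c e"
  proof
    assume "G constant_on ball c e"
    moreover have i: "c + of_real (e / 2) * \<i> \<in> ball c e" "c \<in> ball c e"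
      using e by (auto simp: dist_norm norm_mult)
    ultimately have "G (c + of_real (e / 2) * \<i>) = G c" unfolding constant_on_def by metis
    then have "c + of_real (e / 2) * \<i> \<in> \<real>" using Gre[OF i(1)] by (simp add: G_def)
    then show False using e by (simp add: complex_is_Real_iff c_def)
  qed
  obtain q r n where q: "0 < n" "0 < r" "ball c r \<subseteq> ball c e" "q holomorphic_on ball c r"
    "\<And>w. w \<in> ball c r \<Longrightarrow> G w = (w - c)^n * q w" "\<And>w. w \<in> ball c r \<Longrightarrow> q w \<noteq> 0"
  proof (rule holomorphic_factor_zero_nonconstant[OF holG _ _ _ _ nc, of c])
  qed (use e in \<open>auto simp: G_def\<close>)
  have [simp]: "c \<in> ball c r" using q by simp
  have qc: "isCont q c"
    using q(2,4) holomorphic_on_imp_continuous_on continuous_on_interior by (metis \<open>c \<in> ball c r\<close> interior_open open_ball)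
  have ray_lim: "((\<lambda>t. q (c + of_real t * cis \<theta>)) \<longlongrightarrow> q c) (at_right 0)" for \<theta>
  proof -
    have "((\<lambda>t. c + of_real t * cis \<theta>) \<longlongrightarrow> c + of_real 0 * cis \<theta>) (at_right 0)"
      by (intro tendsto_intros)
    then show ?thesis using isCont_tendsto_compose[OF qc] by simp
  qed
  have small: "\<forall>\<^sub>F t in at_right (0::real). 0 < t \<and> t < r"
    using q(2) by (simp add: eventually_at_right_less eventually_conj eventually_at_right_field) blast
  have inb: "c + of_real t * cis \<theta> \<in> ball c r" if "0 < t" "t < r" for t \<theta>
    using that by (simp add: dist_norm norm_mult)
  have Gray: "Im (G (c + of_real t * cis \<theta>)) = t ^ n * Im (cis (real n * \<theta>) * q (c + of_real t * cis \<theta>))"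
    if "0 < t" "t < r" for t \<theta>
  proof -
    have "G (c + of_real t * cis \<theta>) = of_real (t ^ n) * (cis (real n * \<theta>) * q (c + of_real t * cis \<theta>))"
      using q(5)[OF inb[OF that]] by (simp add: power_mult_distrib Complex.DeMoivre)
    then show ?thesis by (simp only: Im_complex_of_real Re_complex_of_real times_complex.sel mult_zero_left add_0_right)
  qed
  have qreal: "Im (q c) = 0"
  proof -
    have "\<forall>\<^sub>F t in at_right 0. Im (q (c + of_real t * cis 0)) = 0"
      using small
    proof eventually_elim
      case (elim t)
      have "c + of_real t * cis 0 \<in> \<real>" by (simp add: c_def)
      then have "G (c + of_real t * cis 0) \<in> \<real>" using inb[of t 0] elim q(3) Gre by blast
      then show ?case using Gray[of t 0] elim by (simp add: complex_is_Real_iff)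
    qed
    then have "((\<lambda>t. Im (q (c + of_real t * cis 0))) \<longlongrightarrow> 0) (at_right 0)"
      by (simp add: tendsto_eventually)
    moreover have "((\<lambda>t. Im (q (c + of_real t * cis 0))) \<longlongrightarrow> Im (q c)) (at_right 0)"
      by (intro tendsto_intros ray_lim)
    ultimately show ?thesis
      by (meson tendsto_unique trivial_limit_at_right_real)
  qed
  have Rq: "Re (q c) \<noteq> 0" using qreal q(6)[OF \<open>c \<in> ball c r\<close>] by (simp add: complex_eq_iff)
  have "n = 1"
  proof (rule ccontr)
    assume "n \<noteq> 1"
    then have n: "n \<ge> 2" using q(1) by simp
    \<comment> \<open>The rays at angles \<open>\<alpha>\<close> and \<open>3 * \<alpha>\<close> bisect the first two sectors between the zero
      directions of \<open>sin (n * \<theta>)\<close>; \<open>n \<ge> 2\<close> is what keeps \<open>3 * \<alpha>\<close> below \<open>\<pi>\<close>.\<close>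
    define \<alpha> where "\<alpha> = pi / (2 * n)"
    have \<alpha>: "0 < \<alpha>" "\<alpha> < pi" "0 < 3 * \<alpha>" "3 * \<alpha> < pi" 
      using n by (auto simp: \<alpha>_def field_simps)
    have "cis (n * \<alpha>) = \<i>"
      using n by (simp add: \<alpha>_def)
    moreover have "cis (n * (3 * \<alpha>)) = - \<i>"
    proof -
      have angle: "real n * (3 * \<alpha>) = pi + pi / 2" using n by (simp add: \<alpha>_def field_simps)
      show ?thesis unfolding angle cis_mult[symmetric] by simp
    qed
    ultimately have lims: "((\<lambda>t. Im (cis (n * \<alpha>) * q (c + of_real t * cis \<alpha>))
          * Im (cis (n * (3 * \<alpha>)) * q (c + of_real t * cis (3 * \<alpha>)))) \<longlongrightarrow> Im (\<i> * q c) * Im (- \<i> * q c)) (at_right 0)"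
      by (simp only:) (intro tendsto_intros ray_lim)
    have "Im (\<i> * q c) * Im (- \<i> * q c) < 0"
      using Rq by (simp add: zero_less_mult_iff) (metis linorder_neqE_linordered_idom)
    then have "\<forall>\<^sub>F t in at_right 0. Im (cis (n * \<alpha>) * q (c + of_real t * cis \<alpha>))
          * Im (cis (n * (3 * \<alpha>)) * q (c + of_real t * cis (3 * \<alpha>))) < 0"
      using lims order_tendstoD(2) by blast
    then have "\<forall>\<^sub>F t in at_right (0::real). False"
      using small
    proof eventually_elim
      case (elim t)
      define U where "U = ball c e \<inter> {z. Im z > 0}"
      have U: "c + of_real t * cis \<theta> \<in> U" if "0 < \<theta>" "\<theta> < pi" for \<theta>
        using inb[of t \<theta>] elim q(3) that by (auto simp: U_def c_def sin_gt_zero)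
      have "Im (G (c + of_real t * cis \<alpha>)) * Im (G (c + of_real t * cis (3*\<alpha>))) < 0"
      proof -
        have "Im (G (c + of_real t * cis \<alpha>)) * Im (G (c + of_real t * cis (3*\<alpha>))) =
          (t ^ n * t ^ n) * (Im (cis (n * \<alpha>) * q (c + of_real t * cis \<alpha>))
            * Im (cis (n * (3 * \<alpha>)) * q (c + of_real t * cis (3 * \<alpha>))))"
          unfolding Gray[OF conjunct1[OF elim(2)] conjunct2[OF elim(2)]]
          by (simp only: mult.assoc mult.left_commute)
        then show ?thesis using mult_pos_neg[of "t ^ n * t ^ n", OF _ elim(1)] elim(2) by simp
      qed
      moreover have "connected ((\<lambda>z. Im (G z)) ` U)"
      proof (rule connected_continuous_image)
        show "connected U" unfolding U_def
          by (intro convex_connected convex_Int convex_ball convex_halfspace_Im_gt)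
        show "continuous_on U (\<lambda>z. Im (G z))"
          by (intro continuous_intros continuous_on_subset[OF holomorphic_on_imp_continuous_on[OF holG]]) (auto simp: U_def)
      qed
      moreover have "0 \<notin> (\<lambda>z. Im (G z)) ` U"
        using Gre by (fastforce simp: U_def complex_is_Real_iff)
      ultimately show False
        using imageI[OF U[OF \<alpha>(1,2)], of "\<lambda>z. Im (G z)"] imageI[OF U[OF \<alpha>(3,4)], of "\<lambda>z. Im (G z)"]
        unfolding connected_iff_interval mult_less_0_iff by (meson less_imp_le)
    qed
    then show False by (simp add: trivial_limit_def[symmetric])
  qed
  have "(F has_field_derivative q c) (at c)"
    unfolding has_field_derivative_iff
  proof (rule Lim_transform_eventually)
    show "q \<midarrow>c\<rightarrow> q c" using qc by (simp add: isCont_def)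
    have "\<forall>\<^sub>F w in at c. w \<in> ball c r \<and> w \<noteq> c"
      using eventually_at_in_open[of "ball c r" c] q(2) by simp
    then show "\<forall>\<^sub>F w in at c. q w = (F w - F c) / (w - c)"
      by eventually_elim (use q(5) \<open>n = 1\<close> in \<open>simp add: G_def\<close>)
  qed
  then show ?thesis using Rq by (auto simp: c_def DERIV_imp_deriv)
qed

section \<open>Positive Jacobian\<close>

text \<open>
  Near \<open>c\<close> the increments of \<open>h\<close> and \<open>g\<close> differ from those of their linear parts by at most
  \<open>\<epsilon> * norm (z - w)\<close>. A collision \<open>h z - h w = - cnj (g z - g w)\<close> equates the norms of the two
  increments, which forces \<open>\<bar>h' c\<bar> - \<bar>g' c\<bar> \<le> 2 * \<epsilon>\<close>; taking \<open>\<epsilon>\<close> to be a third of the gap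
  excludes this.
\<close>
lemma locally_injective_if_norm_deriv_less:
  assumes "h holomorphic_on S" "g holomorphic_on S" "open S" "c \<in> S"
    and less: "norm (deriv g c) < norm (deriv h c)"
  obtains r where "r > 0" "ball c r \<subseteq> S" "inj_on (\<lambda>z. h z + cnj (g z)) (ball c r)"
proof -
  define \<epsilon> where "\<epsilon> = (norm (deriv h c) - norm (deriv g c)) / 3"
  have \<epsilon>: "\<epsilon> > 0" using less by (simp add: \<epsilon>_def)
  have lin: "\<exists>r>0. ball c r \<subseteq> S \<and> (\<forall>z\<in>ball c r. \<forall>w\<in>ball c r.
      norm ((k z - k w) - deriv k c * (z - w)) \<le> \<epsilon> * norm (z - w))"
    if k: "k holomorphic_on S" for k
  proof -
    have "deriv k holomorphic_on S" using k assms(3) by (rule holomorphic_deriv)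
    then have "continuous_on S (deriv k)" by (rule holomorphic_on_imp_continuous_on)
    then have "isCont (deriv k) c" using assms by (simp add: continuous_on_eq_continuous_at)
    then have "\<forall>\<^sub>F z in nhds c. dist (deriv k z) (deriv k c) < \<epsilon>"
      using \<epsilon> by (simp add: isCont_def tendsto_iff eventually_nhds_conv_at tendsto_at_iff_tendsto_nhds)
    moreover have "\<forall>\<^sub>F z in nhds c. z \<in> S" using assms by (simp add: eventually_nhds_in_open)
    ultimately have "\<forall>\<^sub>F z in nhds c. z \<in> S \<and> dist (deriv k z) (deriv k c) < \<epsilon>"
      by eventually_elim auto
    then obtain r where r: "r > 0" "\<And>z. dist z c < r \<Longrightarrow> z \<in> S \<and> dist (deriv k z) (deriv k c) < \<epsilon>"
      by (auto simp: eventually_nhds_metric)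
    have "norm ((k z - deriv k c * z) - (k w - deriv k c * w)) \<le> \<epsilon> * norm (z - w)"
      if "z \<in> ball c r" "w \<in> ball c r" for z w
    proof (rule field_differentiable_bound[OF convex_ball _ _ that])
      fix u assume u: "u \<in> ball c r"
      then have "(k has_field_derivative deriv k u) (at u)"
        using r(2)[of u] k assms(3) by (simp add: holomorphic_derivI dist_commute)
      then show "((\<lambda>z. k z - deriv k c * z) has_field_derivative deriv k u - deriv k c) (at u within ball c r)"
        by (intro has_field_derivative_at_within[OF DERIV_diff] DERIV_cmult_Id)
      show "norm (deriv k u - deriv k c) \<le> \<epsilon>" using r(2)[of u] u by (simp add: dist_commute) (simp add: dist_norm norm_minus_commute)
    qed
    then show ?thesis using r by (intro exI[of _ r]) (auto simp: algebra_simps dist_commute)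
  qed
  obtain r1 where r1: "r1 > 0" "ball c r1 \<subseteq> S" "\<And>z w. z \<in> ball c r1 \<Longrightarrow> w \<in> ball c r1 \<Longrightarrow>
      norm ((h z - h w) - deriv h c * (z - w)) \<le> \<epsilon> * norm (z - w)" using lin[OF assms(1)] by blast
  obtain r2 where r2: "r2 > 0" "ball c r2 \<subseteq> S" "\<And>z w. z \<in> ball c r2 \<Longrightarrow> w \<in> ball c r2 \<Longrightarrow>
      norm ((g z - g w) - deriv g c * (z - w)) \<le> \<epsilon> * norm (z - w)" using lin[OF assms(2)] by blast
  have "inj_on (\<lambda>z. h z + cnj (g z)) (ball c (min r1 r2))"
  proof (rule inj_onI, rule ccontr)
    fix z w assume zw: "z \<in> ball c (min r1 r2)" "w \<in> ball c (min r1 r2)"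
      "h z + cnj (g z) = h w + cnj (g w)" "z \<noteq> w"
    have "h z - h w = cnj (g w - g z)" using zw(3) by (simp add: algebra_simps)
    then have eq: "norm (h z - h w) = norm (g z - g w)" by (metis complex_mod_cnj norm_minus_commute)
    have "norm (deriv h c) * norm (z - w) \<le> norm (h z - h w) + \<epsilon> * norm (z - w)"
      using r1(3)[of z w] zw norm_triangle_ineq2[of "deriv h c * (z - w)" "h z - h w"]
      by (simp add: norm_mult norm_minus_commute)
    also have "norm (g z - g w) \<le> norm (deriv g c) * norm (z - w) + \<epsilon> * norm (z - w)"
      using r2(3)[of z w] zw norm_triangle_ineq2[of "g z - g w" "deriv g c * (z - w)"]
      by (simp add: norm_mult)
    then have "norm (h z - h w) \<le> norm (deriv g c) * norm (z - w) + \<epsilon> * norm (z - w)" by (simp add: eq)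
    finally have "(norm (deriv h c) - norm (deriv g c)) * norm (z - w) \<le> 2 * \<epsilon> * norm (z - w)"
      by (simp add: algebra_simps)
    also have "norm (deriv h c) - norm (deriv g c) = 3 * \<epsilon>" by (simp add: \<epsilon>_def)
    finally show False using \<epsilon> zw by simp
  qed
  then show ?thesis using r1 r2 by (intro that[of "min r1 r2"]) auto
qed

text \<open>
  The dilatation is a quotient with removable singularities removed, so \<open>g' = \<omega> h'\<close> is at first
  known only at nearby points where \<open>h'\<close> is nonzero; it reaches \<open>z0\<close> by continuity. There it shows
  that a zero of \<open>h'\<close> would also be one of \<open>g'\<close>, which \<open>h' z0 \<noteq> g' z0\<close> rules out, and this makes
  the inequality strict.
\<close>
lemma norm_deriv_less_if_sense_preserving:
  assumes decomp: "harmonic_decomp f h g" and "z0 \<in> unit_disk"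
    and nz: "\<not> (\<forall>\<^sub>F z in nhds z0. deriv h z = 0)"
    and an: "dilatation h g analytic_on {z0}" and less: "norm (dilatation h g z0) < 1"
    and ne: "deriv h z0 \<noteq> deriv g z0"
  shows "norm (deriv g z0) < norm (deriv h z0)"
proof -
  let ?\<omega> = "dilatation h g"
  have hol: "deriv h holomorphic_on unit_disk" "deriv g holomorphic_on unit_disk"
    using decomp by (auto simp: harmonic_decomp_def intro: holomorphic_deriv)
  have cont: "isCont (deriv h) z0" "isCont (deriv g) z0"
    using hol[THEN holomorphic_on_imp_continuous_on] assms(2)
    by (simp_all add: continuous_on_eq_continuous_at)
  obtain b where b: "b \<in> unit_disk" "deriv h b \<noteq> 0"
  proof -
    have "\<forall>\<^sub>F z in nhds z0. z \<in> unit_disk" using assms(2) by (intro eventually_nhds_in_open) auto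
    then show ?thesis using nz that by (metis (mono_tags, lifting) eventually_mono)
  qed
  have "\<forall>\<^sub>F z in at z0. deriv h z \<noteq> 0 \<and> z \<in> unit_disk"
    using hol(1) assms(2) b by (intro non_zero_neighbour_alt[where \<beta> = b]) auto
  then have "\<forall>\<^sub>F z in at z0. ?\<omega> z * deriv h z = deriv g z"
  proof eventually_elim
    case (elim z)
    then have "(\<lambda>z. deriv g z / deriv h z) analytic_on {z}"
      using hol by (intro analytic_on_divide) (auto simp: analytic_at intro!: exI[of _ unit_disk])
    then show ?case using elim by (simp add: dilatation_def)
  qed
  moreover have "((\<lambda>z. ?\<omega> z * deriv h z) \<longlongrightarrow> ?\<omega> z0 * deriv h z0) (at z0)"
    using analytic_at_imp_isCont[OF an] cont(1) by (intro tendsto_mult) (auto simp: isCont_def)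
  ultimately have "(deriv g \<longlongrightarrow> ?\<omega> z0 * deriv h z0) (at z0)"
    by (rule Lim_transform_eventually[rotated])
  moreover have "(deriv g \<longlongrightarrow> deriv g z0) (at z0)"
    using cont(2) by (simp add: isCont_def)
  ultimately have eq: "deriv g z0 = ?\<omega> z0 * deriv h z0"
    using tendsto_unique by (metis at_neq_bot)
  then have "deriv h z0 \<noteq> 0" using ne by auto
  then show ?thesis using less by (simp add: eq norm_mult)
qed

section \<open>From injectivity near each point to an injective neighbourhood\<close>

text \<open>
  \<open>V\<close> collects the points \<open>z\<close> of \<open>U\<close> that are closer to \<open>p z\<close> than some radius of injectivity of \<open>f\<close> at \<open>p z\<close>.
  Points of \<open>V\<close> with the same image have the same \<open>p\<close>-value, so their balls are concentric and the
  larger one contains both points. \<open>V\<close> is open because moving the centre by \<open>\<delta>\<close> costs at most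
  \<open>\<delta>\<close> of the radius.
\<close>
lemma injective_neighbourhood_if_fibres_retract:
  fixes f :: "'a::metric_space \<Rightarrow> 'b" and p :: "'a \<Rightarrow> 'a"
  assumes "open U" "A \<subseteq> U" and cont: "continuous_on U p"
    and fix_p: "\<And>x. x \<in> A \<Longrightarrow> p x = x"
    and fibre: "\<And>z w. z \<in> U \<Longrightarrow> w \<in> U \<Longrightarrow> f z = f w \<Longrightarrow> p z = p w"
    and inj: "\<And>x. x \<in> A \<Longrightarrow> \<exists>r>0. inj_on f (ball x r)"
  obtains V where "open V" "A \<subseteq> V" "V \<subseteq> U" "inj_on f V"
proof
  define V where "V = {z \<in> U. \<exists>r. inj_on f (ball (p z) r) \<and> dist z (p z) < r}"
  show "A \<subseteq> V" using assms(2) fix_p inj by (force simp: V_def)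
  show "V \<subseteq> U" by (auto simp: V_def)
  show "inj_on f V"
  proof (rule inj_onI)
    fix z w assume zw: "z \<in> V" "w \<in> V" "f z = f w"
    then have p: "p z = p w" using fibre by (simp add: V_def)
    obtain r where r: "inj_on f (ball (p z) r)" "dist z (p z) < r" using zw by (auto simp: V_def)
    obtain s where s: "inj_on f (ball (p z) s)" "dist w (p z) < s" using zw p by (auto simp: V_def)
    have "inj_on f (ball (p z) (max r s))" using r s by (cases "r \<le> s") (auto simp: max_def)
    then show "z = w"
      by (rule inj_onD) (use r s zw in \<open>auto simp: dist_commute\<close>)
  qed
  show "open V"
  proof (subst open_subopen, intro ballI)
    fix z0 assume z0: "z0 \<in> V"
    then obtain r where r: "inj_on f (ball (p z0) r)" "dist z0 (p z0) < r" and zU: "z0 \<in> U"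
      by (auto simp: V_def)
    have co: "isCont p z0" using cont zU assms(1) by (simp add: continuous_on_eq_continuous_at)
    define T where "T z = dist z (p z) + dist (p z) (p z0)" for z
    have "(T \<longlongrightarrow> T z0) (nhds z0)" unfolding T_def
      using co by (intro tendsto_intros filterlim_ident) (auto simp: isCont_def tendsto_at_iff_tendsto_nhds)
    then have "\<forall>\<^sub>F z in nhds z0. T z < r" using r(2) by (intro order_tendstoD(2)[of T "T z0"]) (simp_all add: T_def[of z0])
    moreover have "\<forall>\<^sub>F z in nhds z0. z \<in> U" using zU assms(1) by (simp add: eventually_nhds_in_open)
    ultimately have "\<forall>\<^sub>F z in nhds z0. z \<in> V"
    proof eventually_elim
      case (elim z)
      have "ball (p z) (r - dist (p z) (p z0)) \<subseteq> ball (p z0) r"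
      proof
        fix w assume "w \<in> ball (p z) (r - dist (p z) (p z0))"
        then show "w \<in> ball (p z0) r"
          using dist_triangle[of "p z0" w "p z"] by (simp add: dist_commute)
      qed
      then have "inj_on f (ball (p z) (r - dist (p z) (p z0)))" using r(1) inj_on_subset by blast
      then show ?case using elim unfolding V_def T_def by (auto intro!: exI[of _ "r - dist (p z) (p z0)"])
    qed
    then show "\<exists>T. open T \<and> z0 \<in> T \<and> T \<subseteq> V" unfolding eventually_nhds by blast
  qed
qed

section \<open>Behaviour on the real axis\<close>

text \<open>
  The derivative of \<open>f\<close> along the axis is \<open>Re (h' + g')\<close>. Since \<open>F = h - g\<close> is real on the axis,
  \<open>h'\<close> and \<open>g'\<close> have equal imaginary parts there, so if the derivative were zero then
  \<open>h' = - cnj g'\<close>, against \<open>\<bar>g'\<bar> < \<bar>h'\<bar>\<close>.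
\<close>
lemma class_TH_on_real_axis:
  assumes f: "f \<in> class_TH" and x: "-1 < x" "x < 1"
  obtains r d where "r > 0" "inj_on f (ball (complex_of_real x) r)"
    "((\<lambda>t. Re (f (of_real t))) has_real_derivative d) (at x)" "d \<noteq> 0"
proof -
  let ?c = "complex_of_real x"
  have c: "?c \<in> unit_disk" using x by (simp add: abs_less_iff)
  have real_iff: "f z \<in> \<real> \<longleftrightarrow> z \<in> \<real>" if "z \<in> unit_disk" for z
    using f that by (auto simp: class_TH_def)
  obtain h g where hg: "harmonic_decomp f h g" "\<not> (\<forall>\<^sub>F z in nhds ?c. deriv h z = 0)"
        "dilatation h g analytic_on {?c}" "norm (dilatation h g ?c) < 1"
  proof -
    have "sense_preserving_at f ?c" using f c unfolding class_TH_def by blast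
    then show ?thesis using that unfolding sense_preserving_at_def by blast
  qed
  have hol: "h holomorphic_on unit_disk" "g holomorphic_on unit_disk"
    and feq: "\<And>z. z \<in> unit_disk \<Longrightarrow> f z = h z + cnj (g z)"
    using hg(1) by (auto simp: harmonic_decomp_def)
  have dh: "(h has_field_derivative deriv h ?c) (at ?c)" and dg: "(g has_field_derivative deriv g ?c) (at ?c)"
    using hol c by (auto intro: holomorphic_derivI)
  define F where "F z = h z - g z" for z
  have holF: "F holomorphic_on unit_disk" unfolding F_def using hol by (intro holomorphic_intros)
  have F_real: "F z \<in> \<real> \<longleftrightarrow> z \<in> \<real>" if "z \<in> unit_disk" for z
    using real_iff[OF that] feq[OF that] by (simp add: F_def complex_is_Real_iff)
  have dF: "deriv F ?c = deriv h ?c - deriv g ?c"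
    unfolding F_def using dh dg by (intro DERIV_imp_deriv DERIV_diff)
  have dF0: "deriv F ?c \<noteq> 0"
    using deriv_nonzero_if_real_iff_real[OF holF _ c F_real] by simp
  have less: "norm (deriv g ?c) < norm (deriv h ?c)"
    using norm_deriv_less_if_sense_preserving[OF hg(1) c hg(2-4)] dF dF0 by simp
  have near: "\<forall>\<^sub>F t in nhds x. complex_of_real t \<in> unit_disk"
    using eventually_nhds_in_open[of "{-1<..<1}" x] x
    by (auto elim!: eventually_mono simp: abs_less_iff)
  have comp: "((\<lambda>t. k (complex_of_real t)) has_vector_derivative deriv k ?c) (at x)"
    if "(k has_field_derivative deriv k ?c) (at ?c)" for k
    using has_vector_derivative_real_field[OF that] by simp
  have "((\<lambda>t. Im (F (complex_of_real t))) has_real_derivative Im (deriv F ?c)) (at x)"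
    using has_field_derivative_Im[OF comp, of F] holF c
    by (simp add: holomorphic_derivI)
  moreover have "((\<lambda>t. Im (F (complex_of_real t))) has_real_derivative 0) (at x)"
  proof (subst DERIV_cong_ev[where g = "\<lambda>_. 0" and y = x])
    show "\<forall>\<^sub>F t in nhds x. Im (F (complex_of_real t)) = 0"
      using near by eventually_elim (use F_real in \<open>auto simp: complex_is_Real_iff\<close>)
  qed auto
  ultimately have ImF: "Im (deriv h ?c) = Im (deriv g ?c)"
    using DERIV_unique dF by fastforce
  have "((\<lambda>t. Re (h (complex_of_real t)) + Re (g (complex_of_real t))) has_real_derivative
      Re (deriv h ?c) + Re (deriv g ?c)) (at x)"
    using has_field_derivative_Re[OF comp[OF dh]] has_field_derivative_Re[OF comp[OF dg]]
    by (intro DERIV_add)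
  then have der: "((\<lambda>t. Re (f (complex_of_real t))) has_real_derivative Re (deriv h ?c) + Re (deriv g ?c)) (at x)"
  proof (rule DERIV_cong_ev[THEN iffD2, rotated -1])
    show "\<forall>\<^sub>F t in nhds x. Re (f (complex_of_real t)) = Re (h (complex_of_real t)) + Re (g (complex_of_real t))"
      using near by eventually_elim (simp add: feq)
  qed auto
  have "Re (deriv h ?c) + Re (deriv g ?c) \<noteq> 0"
  proof
    assume "Re (deriv h ?c) + Re (deriv g ?c) = 0"
    then have "Re (deriv h ?c) = - Re (deriv g ?c)" by simp
    then have "norm (deriv h ?c) = norm (deriv g ?c)" using ImF by (simp add: cmod_def)
    then show False using less by simp
  qed
  moreover obtain r where "r > 0" "ball ?c r \<subseteq> unit_disk" "inj_on (\<lambda>z. h z + cnj (g z)) (ball ?c r)"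
    using locally_injective_if_norm_deriv_less[OF hol _ c less] by auto
  then have "r > 0" "inj_on f (ball ?c r)"
    using feq by (auto simp: inj_on_def subset_iff)
  ultimately show ?thesis using der that by blast
qed

theorem theorem4:
  fixes f :: "complex \<Rightarrow> complex"
  assumes "f \<in> class_THO"
  shows "\<exists>V. open V \<and> complex_of_real ` {-1<..<1} \<subseteq> V \<and> V \<subseteq> unit_disk \<and> inj_on f V"
proof -
  let ?I = "{-1<..<1::real}"
  have f: "f \<in> class_TH" using assms by (simp add: class_THO_def)
  have contf: "continuous_on unit_disk f"
  proof -
    have "\<exists>h g. harmonic_decomp f h g" using f by (auto simp: class_TH_def)
    then obtain h g where hg: "h holomorphic_on unit_disk" "g holomorphic_on unit_disk"
       "\<And>z. z \<in> unit_disk \<Longrightarrow> f z = h z + cnj (g z)" by (auto simp: harmonic_decomp_def)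
    have "continuous_on unit_disk (\<lambda>z. h z + cnj (g z))"
      using hg by (intro continuous_intros holomorphic_on_imp_continuous_on)
    then show ?thesis by (rule continuous_on_eq) (simp add: hg(3))
  qed
  define \<phi> where "\<phi> t = Re (f (complex_of_real t))" for t
  have der: "\<exists>d. (\<phi> has_real_derivative d) (at x) \<and> d \<noteq> 0" if "x \<in> ?I" for x
    by (rule class_TH_on_real_axis[OF f, of x]) (use that in \<open>auto simp: \<phi>_def[abs_def]\<close>)
  have cont_\<phi>: "continuous_on ?I \<phi>"
    using der by (meson DERIV_isCont continuous_at_imp_continuous_on)
  have no_repeat: "\<phi> x \<noteq> \<phi> y" if xy: "x \<in> ?I" "y \<in> ?I" "x < y" for x y
  proof
    assume "\<phi> x = \<phi> y"
    moreover have "continuous_on {x..y} \<phi>"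
      using cont_\<phi> by (rule continuous_on_subset) (use xy in auto)
    moreover have "\<phi> differentiable (at t)" if "x < t" "t < y" for t
      using der[of t] that xy by (auto simp: real_differentiable_def)
    ultimately obtain z where "x < z" "z < y" "(\<phi> has_real_derivative 0) (at z)"
      using Rolle[OF \<open>x < y\<close>] by metis
    then show False using der[of z] xy DERIV_unique by fastforce
  qed
  then have inj_\<phi>: "inj_on \<phi> ?I"
    by (metis inj_onI linorder_neqE)
  define s where "s = inv_into ?I \<phi>"
  have s: "s (\<phi> x) = x" if "x \<in> ?I" for x
    unfolding s_def using inj_\<phi> that by (rule inv_into_f_f)
  have open_img: "open (\<phi> ` ?I)"
    using invariance_of_domain[OF cont_\<phi> _ inj_\<phi>] by simp
  have cont_s: "continuous_on (\<phi> ` ?I) s"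
    by (rule continuous_on_inverse_open) (use cont_\<phi> s in auto)
  define U where "U = unit_disk \<inter> (\<lambda>z. Re (f z)) -` (\<phi> ` ?I)"
  have contR: "continuous_on unit_disk (\<lambda>z. Re (f z))" using contf by (intro continuous_intros)
  have open_U: "open U" unfolding U_def using contR open_img by (intro continuous_open_preimage) auto
  have axis_U: "complex_of_real ` ?I \<subseteq> U"
    by (auto simp: U_def \<phi>_def abs_less_iff)
  define p where "p z = complex_of_real (s (Re (f z)))" for z
  have cont_p: "continuous_on U p"
  proof -
    have "continuous_on U (\<lambda>z. Re (f z))"
      using contR by (rule continuous_on_subset) (auto simp: U_def)
    then show ?thesis unfolding p_def
      by (intro continuous_on_of_real continuous_on_compose2[OF cont_s]) (auto simp: U_def)
  qed
  have p_axis: "p z = z" if "z \<in> complex_of_real ` ?I" for z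
    using that s by (auto simp: \<phi>_def p_def)
  have local_inj: "\<exists>r>0. inj_on f (ball z r)" if "z \<in> complex_of_real ` ?I" for z
  proof -
    obtain x where x: "-1 < x" "x < 1" "z = complex_of_real x" using \<open>z \<in> complex_of_real ` ?I\<close> by auto
    show ?thesis by (rule class_TH_on_real_axis[OF f x(1,2)]) (use x in auto)
  qed
  obtain V where "open V" "complex_of_real ` ?I \<subseteq> V" "V \<subseteq> U" "inj_on f V"
  proof (rule injective_neighbourhood_if_fibres_retract[OF open_U axis_U cont_p p_axis _ local_inj])
    show "p z = p w" if "f z = f w" for z w using that by (simp add: p_def)
  qed
  then show ?thesis by (intro exI[of _ V]) (auto simp: U_def)
qed

end
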